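(* Let $p$ be a prime and let $G=UT(4,p)$. Then the chromatic number of the reduced commuting graph of $G$ is $\chi(\Gamma_{\mathrm{red}}(G))=p^4-p$.
   Context: For a prime $p$, $UT(4,p)$ is the group, under matrix multiplication, of all $4\times 4$ upper triangular matrices over the finite field $\mathbb{F}_p$ with all diagonal entries equal to $1$. For a finite non-abelian group $G$, the commuting graph $\Gamma(G)$ has vertex set $G$, two distinct vertices $x,y$ being adjacent if and only if $xy=yx$. The reduced commuting graph $\Gamma_{\mathrm{red}}(G)$ is obtained from $\Gamma(G)$ by deleting the vertices in the center $Z(G)$ of $G$ (i.e. it is the induced subgraph on $G\setminus Z(G)$). The chromatic number $\chi$ is the minimum number of colors needed to color the vertices so that adjacent vertices receive different colors. *)

theory Defs
  imports
    "HOL-Number_Theory.Residues"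
    "Jordan_Normal_Form.Matrix"
    "Graph_Theory.Graph_Theory"
begin

text \<open>The matrix product is spelled out with the operations of the ring \<open>R\<close>: the library's
  product of matrices uses the type-class operations of the entries, which for
  \<open>residue_ring p\<close> are those of the integers and not of the field with \<open>p\<close> elements.\<close>

definition UT :: "nat \<Rightarrow> ('a, 'b) ring_scheme \<Rightarrow> 'a mat monoid" where
  "UT n R =
    \<lparr>carrier = {A \<in> carrier_mat n n.
        (\<forall>i<n. \<forall>j<n. A $$ (i, j) \<in> carrier R) \<and>
        (\<forall>i<n. \<forall>j<i. A $$ (i, j) = \<zero>\<^bsub>R\<^esub>) \<and>
        (\<forall>i<n. A $$ (i, i) = \<one>\<^bsub>R\<^esub>)},
     monoid.mult = \<lambda>A B. mat n n (\<lambda>(i, j). \<Oplus>\<^bsub>R\<^esub>k\<in>{..<n}. A $$ (i, k) \<otimes>\<^bsub>R\<^esub> B $$ (k, j)),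
     one = mat n n (\<lambda>(i, j). if i = j then \<one>\<^bsub>R\<^esub> else \<zero>\<^bsub>R\<^esub>)\<rparr>"

definition group_center :: "('a, 'b) monoid_scheme \<Rightarrow> 'a set" where
  "group_center G = {z \<in> carrier G. \<forall>x\<in>carrier G. z \<otimes>\<^bsub>G\<^esub> x = x \<otimes>\<^bsub>G\<^esub> z}"

text \<open>Simple graphs are symmetric loop-free digraphs: an edge is a pair of opposite arcs.\<close>

definition commuting_graph :: "('a, 'b) monoid_scheme \<Rightarrow> 'a pair_pre_digraph" where
  "commuting_graph G =
    \<lparr>pverts = carrier G,
     parcs = {(x, y). x \<in> carrier G \<and> y \<in> carrier G \<and> x \<noteq> y \<and> x \<otimes>\<^bsub>G\<^esub> y = y \<otimes>\<^bsub>G\<^esub> x}\<rparr>"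

definition reduced_commuting_graph :: "('a, 'b) monoid_scheme \<Rightarrow> ('a, 'a \<times> 'a) pre_digraph" where
  "reduced_commuting_graph G =
    with_proj (commuting_graph G) \<restriction> (carrier G - group_center G)"

definition proper_coloring :: "('a, 'b) pre_digraph \<Rightarrow> nat \<Rightarrow> ('a \<Rightarrow> nat) \<Rightarrow> bool" where
  "proper_coloring \<Gamma> k c \<longleftrightarrow>
    (\<forall>v\<in>verts \<Gamma>. c v < k) \<and> (\<forall>e\<in>arcs \<Gamma>. c (tail \<Gamma> e) \<noteq> c (head \<Gamma> e))"

text \<open>Meaningful for graphs with some proper coloring by finitely many colors, in particular
  for all finite loop-free graphs.\<close>

definition chromatic_number :: "('a, 'b) pre_digraph \<Rightarrow> nat" where
  "chromatic_number \<Gamma> = (LEAST k. \<exists>c. proper_coloring \<Gamma> k c)"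

end

theory Submission
  imports Defs
begin

text \<open>Over a finite field with \<open>q\<close> elements, the matrices of \<open>UT 4\<close> whose entries at \<open>(0,1)\<close> and
  \<open>(2,3)\<close> vanish form an abelian subgroup \<open>H\<close> of order \<open>q^4\<close>: the products that could depend on
  the order of the factors all involve one of these two entries. The center consists of the \<open>q\<close>
  matrices that differ from the identity at most in the corner, and it lies in \<open>H\<close>. So the
  noncentral elements of \<open>H\<close> are a clique of size \<open>q^4 - q\<close>, which is the lower bound.

  For the upper bound, color this clique with distinct colors and extend the coloring greedily. This
  never needs a new color, since every element \<open>x\<close> outside \<open>H\<close> has a centralizer of at most \<open>q^4\<close>
  elements (lemma \<open>card_centralizer_UT_4_le\<close>): the centralizer contains \<open>x\<close> and the whole center, so
  \<open>x\<close> has fewer than \<open>q^4 - q\<close> neighbors. Elements of \<open>H\<close> may have much larger centralizers, as the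
  matrices of the commutator subgroup do; this is why the clique is colored first.

  The greedy argument is made for digraphs in lemma \<open>chromatic_number_eq_card_clique\<close> and for
  commuting graphs in lemma \<open>chromatic_number_reduced_commuting_graph\<close>. The group-theoretic input
  is the criterion \<open>ut4_commute_iff\<close> for two matrices to commute.\<close>

text \<open>In this theory \<open>\<oplus>\<close> always denotes addition in a ring, never the joining of walks.\<close>

no_notation vwalk_join (infixr "\<oplus>" 65)

section \<open>Greedy coloring around a large clique\<close>

text \<open>Each vertex of \<open>W\<close> sees fewer than \<open>k\<close> other vertices, hence fewer than \<open>k\<close> colors, whenever
  its turn comes. Vertices of \<open>K\<close> may have any number of neighbors, because their colors are given
  beforehand.\<close>

lemma greedy_coloring_extends:
  fixes E :: "'v \<Rightarrow> 'v \<Rightarrow> bool"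
  assumes "finite W" "finite K" and sym: "\<And>u v. E u v \<Longrightarrow> E v u" and irrefl: "\<And>v. \<not> E v v"
    and c: "\<forall>v\<in>K. c v < k" "\<forall>u\<in>K. \<forall>v\<in>K. E u v \<longrightarrow> c u \<noteq> c v"
    and few: "\<And>v. v \<in> W \<Longrightarrow> card {u \<in> K \<union> W. E u v} < k"
  shows "\<exists>c' :: 'v \<Rightarrow> nat. (\<forall>v\<in>K \<union> W. c' v < k) \<and> (\<forall>u\<in>K \<union> W. \<forall>v\<in>K \<union> W. E u v \<longrightarrow> c' u \<noteq> c' v)"
  using assms(1) few
proof (induction W rule: finite_induct)
  case empty
  then show ?case using c by auto
next
  case (insert w W)
  have fin: "finite (K \<union> W)" using insert.hyps \<open>finite K\<close> by simp
  have "card {u \<in> K \<union> W. E u v} < k" if "v \<in> W" for v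
  proof -
    have "card {u \<in> K \<union> W. E u v} \<le> card {u \<in> K \<union> insert w W. E u v}"
      using fin by (intro card_mono) auto
    with insert.prems[of v] that show ?thesis by simp
  qed
  from insert.IH[OF this] obtain c' where c': "\<forall>v\<in>K \<union> W. c' v < k"
    "\<forall>u\<in>K \<union> W. \<forall>v\<in>K \<union> W. E u v \<longrightarrow> c' u \<noteq> c' v" by blast
  show ?case
  proof (cases "w \<in> K")
    case True
    then have "K \<union> insert w W = K \<union> W" by auto
    with c' show ?thesis by auto
  next
    case False
    define N where "N = {u \<in> K \<union> W. E u w}"
    have finN: "finite N" using fin by (simp add: N_def)
    have "card (c' ` N) \<le> card N" using finN by (rule card_image_le)
    also have "card N \<le> card {u \<in> K \<union> insert w W. E u w}"
      unfolding N_def using fin by (intro card_mono) auto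
    also have "\<dots> < card {..<k}" using insert.prems[of w] by simp
    finally have "\<not> {..<k} \<subseteq> c' ` N"
      using card_mono[of "c' ` N" "{..<k}"] finN by auto
    then obtain m where m: "m < k" "m \<notin> c' ` N" by auto
    have "(\<forall>v\<in>K \<union> insert w W. (c'(w := m)) v < k) \<and>
      (\<forall>u\<in>K \<union> insert w W. \<forall>v\<in>K \<union> insert w W. E u v \<longrightarrow> (c'(w := m)) u \<noteq> (c'(w := m)) v)"
      using c' m sym irrefl False \<open>w \<notin> W\<close> by (auto simp: N_def)
    then show ?thesis by blast
  qed
qed

text \<open>A clique always forces as many colors as it has vertices. That many suffice here, because the
  coloring of the clique by distinct colors extends greedily to the vertices of small degree.\<close>

lemma chromatic_number_eq_card_clique:
  assumes fin: "finite (verts \<Gamma>)"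
    and wf: "wf_digraph \<Gamma>"
    and loopfree: "\<And>v. \<not> v \<rightarrow>\<^bsub>\<Gamma>\<^esub> v"
    and sym: "\<And>u v. u \<rightarrow>\<^bsub>\<Gamma>\<^esub> v \<Longrightarrow> v \<rightarrow>\<^bsub>\<Gamma>\<^esub> u"
    and K: "K \<subseteq> verts \<Gamma>"
    and clique: "\<And>u v. u \<in> K \<Longrightarrow> v \<in> K \<Longrightarrow> u \<noteq> v \<Longrightarrow> u \<rightarrow>\<^bsub>\<Gamma>\<^esub> v"
    and few: "\<And>v. v \<in> verts \<Gamma> - K \<Longrightarrow> card {u \<in> verts \<Gamma>. u \<rightarrow>\<^bsub>\<Gamma>\<^esub> v} < card K"
  shows "chromatic_number \<Gamma> = card K"
proof -
  have finK: "finite K" using K fin finite_subset by blast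
  (* Arcs of a well-formed digraph end in vertices, so a proper coloring is a matter of adjacency. *)
  have proper_iff: "proper_coloring \<Gamma> k c \<longleftrightarrow>
      (\<forall>v\<in>verts \<Gamma>. c v < k) \<and> (\<forall>u\<in>verts \<Gamma>. \<forall>v\<in>verts \<Gamma>. u \<rightarrow>\<^bsub>\<Gamma>\<^esub> v \<longrightarrow> c u \<noteq> c v)" for k c
    using wf unfolding proper_coloring_def arcs_ends_def arc_to_ends_def wf_digraph_def by auto
  have V: "K \<union> (verts \<Gamma> - K) = verts \<Gamma>" using K by auto
  obtain c0 where "bij_betw c0 K {0..<card K}"
    using ex_bij_betw_finite_nat[OF finK] by auto
  then have c0: "\<forall>v\<in>K. c0 v < card K" "\<forall>u\<in>K. \<forall>v\<in>K. u \<rightarrow>\<^bsub>\<Gamma>\<^esub> v \<longrightarrow> c0 u \<noteq> c0 v"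
    using loopfree by (auto simp: bij_betw_def inj_on_def)
  have "\<exists>c. (\<forall>v\<in>K \<union> (verts \<Gamma> - K). c v < card K) \<and>
      (\<forall>u\<in>K \<union> (verts \<Gamma> - K). \<forall>v\<in>K \<union> (verts \<Gamma> - K). u \<rightarrow>\<^bsub>\<Gamma>\<^esub> v \<longrightarrow> c u \<noteq> c v)"
  proof (rule greedy_coloring_extends[OF _ finK _ loopfree c0])
    show "finite (verts \<Gamma> - K)" using fin by simp
    show "v \<rightarrow>\<^bsub>\<Gamma>\<^esub> u" if "u \<rightarrow>\<^bsub>\<Gamma>\<^esub> v" for u v using that by (rule sym)
    show "card {u \<in> K \<union> (verts \<Gamma> - K). u \<rightarrow>\<^bsub>\<Gamma>\<^esub> v} < card K" if "v \<in> verts \<Gamma> - K" for v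
      unfolding V using few[OF that] .
  qed
  then have "\<exists>c. proper_coloring \<Gamma> (card K) c" unfolding proper_iff V .
  moreover have "card K \<le> k" if "proper_coloring \<Gamma> k c" for k c
  proof -
    have "inj_on c K" using that clique K unfolding proper_iff inj_on_def by blast
    moreover have "c ` K \<subseteq> {..<k}" using that K unfolding proper_iff by auto
    ultimately show ?thesis using card_inj_on_le[of c K "{..<k}"] by simp
  qed
  ultimately show ?thesis
    unfolding chromatic_number_def by (intro Least_equality) auto
qed

section \<open>Commuting graphs\<close>

lemma dominates_reduced_commuting_graph_iff:
  "u \<rightarrow>\<^bsub>reduced_commuting_graph G\<^esub> v \<longleftrightarrow>
    u \<in> carrier G - group_center G \<and> v \<in> carrier G - group_center G \<and>
    u \<noteq> v \<and> u \<otimes>\<^bsub>G\<^esub> v = v \<otimes>\<^bsub>G\<^esub> u"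
proof -
  have "arcs_ends (reduced_commuting_graph G) = arcs (reduced_commuting_graph G)"
    by (simp add: reduced_commuting_graph_def arcs_ends_def arc_to_ends_def)
  then show ?thesis
    by (auto simp: reduced_commuting_graph_def commuting_graph_def)
qed

text \<open>The noncentral part of \<open>H\<close> is a clique. An element outside \<open>H\<close> is joined to the noncentral
  elements of its centralizer except itself, and it is this exception that makes the number of its
  neighbors strictly smaller than the size of the clique.\<close>

lemma chromatic_number_reduced_commuting_graph:
  fixes G (structure)
  assumes fin: "finite (carrier G)"
    and center: "group_center G \<subseteq> H" and H: "H \<subseteq> carrier G"
    and comm: "\<And>x y. x \<in> H \<Longrightarrow> y \<in> H \<Longrightarrow> x \<otimes> y = y \<otimes> x"
    and small: "\<And>x. x \<in> carrier G - H \<Longrightarrow> card {y \<in> carrier G. x \<otimes> y = y \<otimes> x} \<le> card H"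
  shows "chromatic_number (reduced_commuting_graph G) = card H - card (group_center G)"
proof -
  let ?Z = "group_center G" and ?\<Gamma> = "reduced_commuting_graph G"
  note dominates_iff = dominates_reduced_commuting_graph_iff[where G = G]
  have finH: "finite H" using H fin by (rule finite_subset)
  have finZ: "finite ?Z" using center finH by (rule finite_subset)
  have verts: "verts ?\<Gamma> = carrier G - ?Z"
    by (simp add: reduced_commuting_graph_def)
  have "arcs ?\<Gamma> \<subseteq> verts ?\<Gamma> \<times> verts ?\<Gamma>" "tail ?\<Gamma> = fst" "head ?\<Gamma> = snd"
    by (auto simp: reduced_commuting_graph_def)
  then have wf: "wf_digraph ?\<Gamma>" unfolding wf_digraph_def by auto
  have "chromatic_number ?\<Gamma> = card (H - ?Z)"
  proof (rule chromatic_number_eq_card_clique[OF _ wf])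
    show "finite (verts ?\<Gamma>)" using fin verts by simp
    show "\<not> v \<rightarrow>\<^bsub>?\<Gamma>\<^esub> v" for v unfolding dominates_iff by blast
    show "v \<rightarrow>\<^bsub>?\<Gamma>\<^esub> u" if "u \<rightarrow>\<^bsub>?\<Gamma>\<^esub> v" for u v using that unfolding dominates_iff by metis
    show "H - ?Z \<subseteq> verts ?\<Gamma>" using H verts by blast
    show "u \<rightarrow>\<^bsub>?\<Gamma>\<^esub> v" if "u \<in> H - ?Z" "v \<in> H - ?Z" "u \<noteq> v" for u v
      using that H comm[of u v] unfolding dominates_iff by blast
    fix v assume "v \<in> verts ?\<Gamma> - (H - ?Z)"
    then have v: "v \<in> carrier G" "v \<notin> ?Z" "v \<notin> H" using verts by blast+
    let ?C = "{y \<in> carrier G. v \<otimes> y = y \<otimes> v}"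
    have Z_le: "?Z \<subseteq> ?C"
    proof
      fix z assume "z \<in> ?Z"
      then have "z \<in> carrier G" "z \<otimes> v = v \<otimes> z" using v(1) unfolding group_center_def by blast+
      then show "z \<in> ?C" by simp
    qed
    have "{u \<in> verts ?\<Gamma>. u \<rightarrow>\<^bsub>?\<Gamma>\<^esub> v} \<subseteq> ?C - ?Z - {v}"
      unfolding dominates_iff by (intro subsetI) (elim CollectE conjE, simp)
    also have "\<dots> \<subset> ?C - ?Z" using v by blast
    finally have "card {u \<in> verts ?\<Gamma>. u \<rightarrow>\<^bsub>?\<Gamma>\<^esub> v} < card (?C - ?Z)"
      using fin by (intro psubset_card_mono) simp_all
    also have "card (?C - ?Z) = card ?C - card ?Z"
      using finZ Z_le by (rule card_Diff_subset)
    also have "\<dots> \<le> card H - card ?Z"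
      using small[of v] v by (intro diff_le_mono) simp
    also have "\<dots> = card (H - ?Z)"
      using center finZ by (simp add: card_Diff_subset)
    finally show "card {u \<in> verts ?\<Gamma>. u \<rightarrow>\<^bsub>?\<Gamma>\<^esub> v} < card (H - ?Z)" .
  qed
  then show ?thesis using center finZ by (simp add: card_Diff_subset)
qed

section \<open>Unitriangular matrices of size four\<close>

text \<open>The arguments run through the entries diagonal by diagonal: first the superdiagonal
  \<open>a\<close>, \<open>b\<close>, \<open>c\<close>, then \<open>d\<close>, \<open>e\<close>, and last the corner \<open>f\<close>.\<close>

definition ut4 :: "('a, 'b) ring_scheme \<Rightarrow> 'a \<Rightarrow> 'a \<Rightarrow> 'a \<Rightarrow> 'a \<Rightarrow> 'a \<Rightarrow> 'a \<Rightarrow> 'a mat" where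
  "ut4 R a b c d e f = mat 4 4 (\<lambda>(i, j).
    [[\<one>\<^bsub>R\<^esub>, a, d, f],
     [\<zero>\<^bsub>R\<^esub>, \<one>\<^bsub>R\<^esub>, b, e],
     [\<zero>\<^bsub>R\<^esub>, \<zero>\<^bsub>R\<^esub>, \<one>\<^bsub>R\<^esub>, c],
     [\<zero>\<^bsub>R\<^esub>, \<zero>\<^bsub>R\<^esub>, \<zero>\<^bsub>R\<^esub>, \<one>\<^bsub>R\<^esub>]] ! i ! j)"

lemma all_less_four: "(\<forall>i<(4::nat). P i) \<longleftrightarrow> P 0 \<and> P 1 \<and> P 2 \<and> P 3"
  by (auto simp: numeral_eq_Suc less_Suc_eq)

lemma all_less_numerals:
  "(\<forall>i<(3::nat). P i) \<longleftrightarrow> P 0 \<and> P 1 \<and> P 2" "(\<forall>i<(2::nat). P i) \<longleftrightarrow> P 0 \<and> P 1"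
  by (auto simp: numeral_eq_Suc less_Suc_eq)

lemma ut4_eq_iff:
  "ut4 R a b c d e f = ut4 R a' b' c' d' e' f' \<longleftrightarrow>
    a = a' \<and> b = b' \<and> c = c' \<and> d = d' \<and> e = e' \<and> f = f'"
  unfolding mat_eq_iff ut4_def by (auto simp: all_less_four)

context cring
begin

lemma carrier_UT_4:
  "carrier (UT 4 R) = {ut4 R a b c d e f | a b c d e f.
    a \<in> carrier R \<and> b \<in> carrier R \<and> c \<in> carrier R \<and> d \<in> carrier R \<and> e \<in> carrier R \<and> f \<in> carrier R}"
proof (intro equalityI subsetI)
  fix A assume A: "A \<in> carrier (UT 4 R)"
  then have "A = ut4 R (A $$ (0,1)) (A $$ (1,2)) (A $$ (2,3)) (A $$ (0,2)) (A $$ (1,3)) (A $$ (0,3))"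
    unfolding mat_eq_iff by (auto simp: UT_def ut4_def all_less_four all_less_numerals)
  moreover have "A $$ (0,1) \<in> carrier R" "A $$ (1,2) \<in> carrier R" "A $$ (2,3) \<in> carrier R"
    "A $$ (0,2) \<in> carrier R" "A $$ (1,3) \<in> carrier R" "A $$ (0,3) \<in> carrier R"
    using A by (simp_all add: UT_def)
  ultimately show "A \<in> {ut4 R a b c d e f | a b c d e f.
    a \<in> carrier R \<and> b \<in> carrier R \<and> c \<in> carrier R \<and> d \<in> carrier R \<and> e \<in> carrier R \<and> f \<in> carrier R}"
    by blast
next
  fix A assume "A \<in> {ut4 R a b c d e f | a b c d e f.
    a \<in> carrier R \<and> b \<in> carrier R \<and> c \<in> carrier R \<and> d \<in> carrier R \<and> e \<in> carrier R \<and> f \<in> carrier R}"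
  then show "A \<in> carrier (UT 4 R)"
    by (auto simp: UT_def ut4_def all_less_four all_less_numerals)
qed

lemma ut4_cases:
  assumes "A \<in> carrier (UT 4 R)"
  obtains a b c d e f where "A = ut4 R a b c d e f"
    "a \<in> carrier R" "b \<in> carrier R" "c \<in> carrier R" "d \<in> carrier R" "e \<in> carrier R" "f \<in> carrier R"
  using assms by (auto simp: carrier_UT_4)

lemma ut4_in_carrier_iff:
  "ut4 R a b c d e f \<in> carrier (UT 4 R) \<longleftrightarrow>
    a \<in> carrier R \<and> b \<in> carrier R \<and> c \<in> carrier R \<and> d \<in> carrier R \<and> e \<in> carrier R \<and> f \<in> carrier R"
  by (auto simp: carrier_UT_4 ut4_eq_iff)

lemma mult_ut4:
  assumes "a \<in> carrier R" "b \<in> carrier R" "c \<in> carrier R" "d \<in> carrier R" "e \<in> carrier R" "f \<in> carrier R"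
    "a' \<in> carrier R" "b' \<in> carrier R" "c' \<in> carrier R" "d' \<in> carrier R" "e' \<in> carrier R" "f' \<in> carrier R"
  shows "ut4 R a b c d e f \<otimes>\<^bsub>UT 4 R\<^esub> ut4 R a' b' c' d' e' f' =
    ut4 R (a \<oplus> a') (b \<oplus> b') (c \<oplus> c') (d \<oplus> d' \<oplus> a \<otimes> b') (e \<oplus> e' \<oplus> b \<otimes> c')
      (f \<oplus> f' \<oplus> (a \<otimes> e' \<oplus> d \<otimes> c'))"
proof -
  have "{..<4} = {0, 1, 2, 3::nat}" by auto
  with assms show ?thesis
    unfolding mat_eq_iff by (simp add: UT_def ut4_def all_less_four a_ac)
qed

text \<open>The products of \<open>mult_ut4\<close> are already sorted so that the parts symmetric in the two factors
  cancel. The three remaining equations come from the entries \<open>(0,2)\<close>, \<open>(1,3)\<close> and \<open>(0,3)\<close>.\<close>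

lemma ut4_commute_iff:
  assumes "a \<in> carrier R" "b \<in> carrier R" "c \<in> carrier R" "d \<in> carrier R" "e \<in> carrier R" "f \<in> carrier R"
    "a' \<in> carrier R" "b' \<in> carrier R" "c' \<in> carrier R" "d' \<in> carrier R" "e' \<in> carrier R" "f' \<in> carrier R"
  shows "ut4 R a b c d e f \<otimes>\<^bsub>UT 4 R\<^esub> ut4 R a' b' c' d' e' f' =
      ut4 R a' b' c' d' e' f' \<otimes>\<^bsub>UT 4 R\<^esub> ut4 R a b c d e f \<longleftrightarrow>
    a \<otimes> b' = a' \<otimes> b \<and> b \<otimes> c' = b' \<otimes> c \<and> a \<otimes> e' \<oplus> d \<otimes> c' = a' \<otimes> e \<oplus> d' \<otimes> c"
  using assms by (simp add: mult_ut4 ut4_eq_iff a_comm[of a'] a_comm[of b'] a_comm[of c']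
      a_comm[of d'] a_comm[of e'] a_comm[of f'])

end

context field
begin

text \<open>Commuting with the three elementary matrices that have a single \<open>\<one>\<close> on the superdiagonal
  already forces all entries but the corner to vanish.\<close>

lemma group_center_UT_4: "group_center (UT 4 R) = {ut4 R \<zero> \<zero> \<zero> \<zero> \<zero> f | f. f \<in> carrier R}"
proof (intro equalityI subsetI)
  fix A assume A: "A \<in> group_center (UT 4 R)"
  then obtain a b c d e f where A_eq: "A = ut4 R a b c d e f" and
    R: "a \<in> carrier R" "b \<in> carrier R" "c \<in> carrier R" "d \<in> carrier R" "e \<in> carrier R" "f \<in> carrier R"
    by (auto simp: group_center_def carrier_UT_4)
  have *: "A \<otimes>\<^bsub>UT 4 R\<^esub> B = B \<otimes>\<^bsub>UT 4 R\<^esub> A" if "B \<in> carrier (UT 4 R)" for B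
    using A that by (auto simp: group_center_def)
  have "b = \<zero> \<and> e = \<zero>" using *[of "ut4 R \<one> \<zero> \<zero> \<zero> \<zero> \<zero>"] R
    by (auto simp: ut4_in_carrier_iff A_eq ut4_commute_iff)
  moreover have "a = \<zero> \<and> c = \<zero>" using *[of "ut4 R \<zero> \<one> \<zero> \<zero> \<zero> \<zero>"] R
    by (auto simp: ut4_in_carrier_iff A_eq ut4_commute_iff)
  moreover have "d = \<zero>" using *[of "ut4 R \<zero> \<zero> \<one> \<zero> \<zero> \<zero>"] R
    by (auto simp: ut4_in_carrier_iff A_eq ut4_commute_iff)
  ultimately show "A \<in> {ut4 R \<zero> \<zero> \<zero> \<zero> \<zero> f | f. f \<in> carrier R}" using R A_eq by auto
next
  fix A assume "A \<in> {ut4 R \<zero> \<zero> \<zero> \<zero> \<zero> f | f. f \<in> carrier R}"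
  then show "A \<in> group_center (UT 4 R)"
    by (auto simp: group_center_def ut4_in_carrier_iff ut4_commute_iff elim!: ut4_cases)
qed

text \<open>Let \<open>A = ut4 R a b c d e f\<close>. If \<open>a\<close> is nonzero, the equations of \<open>ut4_commute_iff\<close> can be solved
  for the entries \<open>b'\<close> and \<open>e'\<close> of an element of the centralizer, so that the other four entries
  determine it. If \<open>c\<close> is nonzero, they can be solved for \<open>b'\<close> and \<open>d'\<close>.\<close>

lemma card_centralizer_UT_4_le:
  assumes fin: "finite (carrier R)" and A: "A \<in> carrier (UT 4 R)"
    and outside: "A $$ (0, 1) \<noteq> \<zero> \<or> A $$ (2, 3) \<noteq> \<zero>"
  shows "card {B \<in> carrier (UT 4 R). A \<otimes>\<^bsub>UT 4 R\<^esub> B = B \<otimes>\<^bsub>UT 4 R\<^esub> A} \<le> card (carrier R) ^ 4"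
proof -
  let ?C = "{B \<in> carrier (UT 4 R). A \<otimes>\<^bsub>UT 4 R\<^esub> B = B \<otimes>\<^bsub>UT 4 R\<^esub> A}"
  let ?X = "carrier R \<times> carrier R \<times> carrier R \<times> carrier R"
  obtain a b c d e f where A_eq: "A = ut4 R a b c d e f" and
    R: "a \<in> carrier R" "b \<in> carrier R" "c \<in> carrier R" "d \<in> carrier R" "e \<in> carrier R" "f \<in> carrier R"
    using A by (auto simp: carrier_UT_4)
  have card_X: "card ?X = card (carrier R) ^ 4"
    by (simp add: card_cartesian_product power4_eq_xxxx mult.assoc)
  have "\<exists>g. inj_on g ?C \<and> g ` ?C \<subseteq> ?X"
  proof (cases "a = \<zero>")
    case False
    have "inj_on (\<lambda>B. (B $$ (0,1), B $$ (2,3), B $$ (0,2), B $$ (0,3))) ?C"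
    proof (rule inj_onI)
      fix B B' assume B: "B \<in> ?C" "B' \<in> ?C" and eq: "(B $$ (0,1), B $$ (2,3), B $$ (0,2), B $$ (0,3)) =
        (B' $$ (0,1), B' $$ (2,3), B' $$ (0,2), B' $$ (0,3))"
      from B(1) obtain x y z u v w where B_eq: "B = ut4 R x y z u v w" and
        BR: "x \<in> carrier R" "y \<in> carrier R" "z \<in> carrier R" "u \<in> carrier R" "v \<in> carrier R" "w \<in> carrier R"
        by (auto simp: carrier_UT_4)
      from B(2) obtain x' y' z' u' v' w' where B'_eq: "B' = ut4 R x' y' z' u' v' w'" and
        B'R: "x' \<in> carrier R" "y' \<in> carrier R" "z' \<in> carrier R" "u' \<in> carrier R" "v' \<in> carrier R" "w' \<in> carrier R"
        by (auto simp: carrier_UT_4)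
      have eqs: "x' = x" "z' = z" "u' = u" "w' = w"
        using eq by (auto simp: B_eq B'_eq ut4_def)
      have "a \<otimes> y = a \<otimes> y'" "a \<otimes> v \<oplus> d \<otimes> z = a \<otimes> v' \<oplus> d \<otimes> z"
        using B R BR B'R by (auto simp: A_eq B_eq B'_eq ut4_commute_iff eqs)
      then have "y = y'" "v = v'"
        using R BR B'R False by (auto simp: m_lcancel)
      then show "B = B'" by (simp add: B_eq B'_eq eqs)
    qed
    then show ?thesis by (intro exI conjI, assumption) (auto simp: carrier_UT_4 ut4_def)
  next
    case True
    then have c: "c \<noteq> \<zero>" using outside by (simp add: A_eq ut4_def)
    have "inj_on (\<lambda>B. (B $$ (0,1), B $$ (2,3), B $$ (1,3), B $$ (0,3))) ?C"
    proof (rule inj_onI)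
      fix B B' assume B: "B \<in> ?C" "B' \<in> ?C" and eq: "(B $$ (0,1), B $$ (2,3), B $$ (1,3), B $$ (0,3)) =
        (B' $$ (0,1), B' $$ (2,3), B' $$ (1,3), B' $$ (0,3))"
      from B(1) obtain x y z u v w where B_eq: "B = ut4 R x y z u v w" and
        BR: "x \<in> carrier R" "y \<in> carrier R" "z \<in> carrier R" "u \<in> carrier R" "v \<in> carrier R" "w \<in> carrier R"
        by (auto simp: carrier_UT_4)
      from B(2) obtain x' y' z' u' v' w' where B'_eq: "B' = ut4 R x' y' z' u' v' w'" and
        B'R: "x' \<in> carrier R" "y' \<in> carrier R" "z' \<in> carrier R" "u' \<in> carrier R" "v' \<in> carrier R" "w' \<in> carrier R"
        by (auto simp: carrier_UT_4)
      have eqs: "x' = x" "z' = z" "v' = v" "w' = w"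
        using eq by (auto simp: B_eq B'_eq ut4_def)
      have "y \<otimes> c = y' \<otimes> c" "x \<otimes> e \<oplus> u \<otimes> c = x \<otimes> e \<oplus> u' \<otimes> c"
        using B R BR B'R by (auto simp: A_eq B_eq B'_eq ut4_commute_iff eqs)
      then have "y = y'" "u = u'"
        using R BR B'R c by (auto simp: m_rcancel)
      then show "B = B'" by (simp add: B_eq B'_eq eqs)
    qed
    then show ?thesis by (intro exI conjI, assumption) (auto simp: carrier_UT_4 ut4_def)
  qed
  then show ?thesis
    using card_inj_on_le[of _ ?C ?X] fin card_X by auto
qed

section \<open>The chromatic number\<close>

theorem chromatic_number_reduced_commuting_graph_UT_4:
  assumes fin: "finite (carrier R)"
  shows "chromatic_number (reduced_commuting_graph (UT 4 R)) = card (carrier R) ^ 4 - card (carrier R)"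
proof -
  define H where "H = (\<lambda>(b, d, e, f). ut4 R \<zero> b \<zero> d e f) `
    (carrier R \<times> carrier R \<times> carrier R \<times> carrier R)"
  have H_I: "ut4 R \<zero> b \<zero> d e f \<in> H"
    if "b \<in> carrier R" "d \<in> carrier R" "e \<in> carrier R" "f \<in> carrier R" for b d e f
    unfolding H_def using that by (intro image_eqI[of _ _ "(b, d, e, f)"]) simp_all
  have H_E: "\<exists>b d e f. x = ut4 R \<zero> b \<zero> d e f \<and>
      b \<in> carrier R \<and> d \<in> carrier R \<and> e \<in> carrier R \<and> f \<in> carrier R" if "x \<in> H" for x
    using that unfolding H_def by (elim imageE SigmaE) (clarsimp simp: ut4_eq_iff)
  have "inj_on (\<lambda>(b, d, e, f). ut4 R \<zero> b \<zero> d e f) X" for X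
    by (intro inj_onI) (clarsimp simp: ut4_eq_iff)
  then have card_H: "card H = card (carrier R) ^ 4"
    unfolding H_def
    by (subst card_image) (simp_all add: card_cartesian_product power4_eq_xxxx mult.assoc)
  have "group_center (UT 4 R) = ut4 R \<zero> \<zero> \<zero> \<zero> \<zero> ` carrier R"
    unfolding group_center_UT_4 by blast
  then have card_Z: "card (group_center (UT 4 R)) = card (carrier R)"
    by (simp add: card_image inj_on_def ut4_eq_iff)
  have "carrier (UT 4 R) \<subseteq> (\<lambda>(a, b, c, d, e, f). ut4 R a b c d e f) `
      (carrier R \<times> carrier R \<times> carrier R \<times> carrier R \<times> carrier R \<times> carrier R)"
  proof
    fix A assume "A \<in> carrier (UT 4 R)"
    then show "A \<in> (\<lambda>(a, b, c, d, e, f). ut4 R a b c d e f) `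
      (carrier R \<times> carrier R \<times> carrier R \<times> carrier R \<times> carrier R \<times> carrier R)"
    proof (rule ut4_cases)
      fix a b c d e f assume "A = ut4 R a b c d e f"
        "a \<in> carrier R" "b \<in> carrier R" "c \<in> carrier R" "d \<in> carrier R" "e \<in> carrier R" "f \<in> carrier R"
      then show ?thesis by (intro image_eqI[of _ _ "(a, b, c, d, e, f)"]) simp_all
    qed
  qed
  then have "finite (carrier (UT 4 R))" by (rule finite_subset) (use fin in simp)
  then have "chromatic_number (reduced_commuting_graph (UT 4 R)) = card H - card (group_center (UT 4 R))"
  proof (rule chromatic_number_reduced_commuting_graph)
    show "group_center (UT 4 R) \<subseteq> H" using H_I unfolding group_center_UT_4 by blast
    show "H \<subseteq> carrier (UT 4 R)"
    proof
      fix x assume "x \<in> H"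
      from H_E[OF this] show "x \<in> carrier (UT 4 R)" by (elim exE conjE) (simp add: ut4_in_carrier_iff)
    qed
    show "x \<otimes>\<^bsub>UT 4 R\<^esub> y = y \<otimes>\<^bsub>UT 4 R\<^esub> x" if "x \<in> H" "y \<in> H" for x y
      using H_E[OF that(1)] H_E[OF that(2)] by (elim exE conjE) (simp add: ut4_commute_iff)
    fix A assume A: "A \<in> carrier (UT 4 R) - H"
    then obtain a b c d e f where A_eq: "A = ut4 R a b c d e f" and
      R: "a \<in> carrier R" "b \<in> carrier R" "c \<in> carrier R" "d \<in> carrier R" "e \<in> carrier R" "f \<in> carrier R"
      using ut4_cases[of A] by blast
    have "a \<noteq> \<zero> \<or> c \<noteq> \<zero>" using A H_I[OF R(2,4,5,6)] A_eq by blast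
    then have "A $$ (0, 1) \<noteq> \<zero> \<or> A $$ (2, 3) \<noteq> \<zero>" by (simp add: A_eq ut4_def)
    with A fin show "card {B \<in> carrier (UT 4 R). A \<otimes>\<^bsub>UT 4 R\<^esub> B = B \<otimes>\<^bsub>UT 4 R\<^esub> A} \<le> card H"
      unfolding card_H by (intro card_centralizer_UT_4_le) simp_all
  qed
  then show ?thesis unfolding card_H card_Z .
qed

end

theorem theorem6p3:
  fixes p :: nat
  assumes "Factorial_Ring.prime p"
  shows "chromatic_number (reduced_commuting_graph (UT 4 (residue_ring (int p)))) = p ^ 4 - p"
proof -
  interpret residues_prime p "residue_ring (int p)"
    using assms by unfold_locales simp_all
  show ?thesis
    using field.chromatic_number_reduced_commuting_graph_UT_4[OF is_field finite]
    by (simp add: res_carrier_eq)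
qed

end
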